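(* Consider named agents in the asynchronous model with FW whiteboards, with half-duplex or full-duplex links. In each of these models, for every $k\ge 1$, the quiescence number of the $k$-gossip problem is $0$; that is, a $0$-quiescent self-stabilizing solution exists and no $l$-quiescent self-stabilizing solution exists for any $l \ge 1$.
   Context: Network: a finite connected graph $G=(V,E)$. Nodes are anonymous (nodes of the same degree are identical). Each node labels its incident links with locally distinct labels; nothing else is assumed about the labels. Each node has a whiteboard (a public memory). Agents: $k$ mobile agents, each a deterministic state machine, are present at all times. In the named agent model each agent has a unique constant identifier from an infinite totally ordered domain (e.g. $\mathbb{N}$). When an agent at a node executes its action, it may change its state, write on the node's whiteboard, and move to a neighboring node (or stay), based only on: its own state (and identifier), the states of the agents currently at the same node, the local link labels of the node (and possibly the label of the incoming link), and the contents of the node's whiteboard. The algorithm is the same for all agents; it is given neither $k$ nor the network. Asynchronous model: there is no bound on the number of moves an agent can make between two moves of another agent, but each agent is always eventually allowed to execute its action; agents at the same node act sequentially, agents at different nodes may act concurrently. Links. Full-duplex: two agents at neighboring nodes can swap positions simultaneously over the link joining them without meeting. Half-duplex: only one direction can be used at a time; if two agents at opposite ends try to cross simultaneously, only one succeeds. FW whiteboards: any information can be stored on whiteboards, including gossip information. $k$-gossip problem: each of the $k$ agents is given an initial piece of information (gossip information), treated as opaque. Gossip information is transferred from agent to agent by meeting at a node or by being written on and read from a whiteboard; agents may relay all gossip information collected. The goal is that every agent obtains the gossip information of all agents. Self-stabilizing solution: one algorithm, not depending on $k$ or on the network, such that for every network, every number of agents, and every initial configuration (arbitrary agent locations and states,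 arbitrary whiteboard contents), in every execution every agent eventually knows the gossip information of all agents in the system. $l$-quiescent (for an integer $l$, when $k$ agents are present): every execution with $k$ agents reaches a configuration after which $l$ or more agents remain still (never move) forever. The quiescence number of the $k$-gossip problem in a model is the maximum integer $l$ such that an $l$-quiescent self-stabilizing solution exists, and it is $-1$ if no $0$-quiescent self-stabilizing solution exists. *)

theory Defs
  imports "HOL-Library.Infinite_Typeclass"
begin

(* lab G u v is the label that u gives to its link to v.  Vertex names are never
   shown to agents, and every finite graph has a copy on natural numbers. *)
record 'lab network =
  nodes :: "nat set"
  adj :: "(nat \<times> nat) set"
  lab :: "nat \<Rightarrow> nat \<Rightarrow> 'lab"

definition is_network :: "'lab network \<Rightarrow> bool" where
  "is_network G \<longleftrightarrow>
     finite (nodes G) \<and> nodes G \<noteq> {} \<and>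
     adj G \<subseteq> nodes G \<times> nodes G \<and> sym (adj G) \<and> irrefl (adj G) \<and>
     (\<forall>u\<in>nodes G. \<forall>v\<in>nodes G. (u, v) \<in> (adj G)\<^sup>*) \<and>
     (\<forall>u\<in>nodes G. inj_on (lab G u) (adj G `` {u}))"

definition ports :: "'lab network \<Rightarrow> nat \<Rightarrow> 'lab set" where
  "ports G u = lab G u ` (adj G `` {u})"

datatype link_model = Full_Duplex | Half_Duplex

(* What an agent sees when it acts: own identifier and state, states of the other
   agents at the node, local link labels, label of the link by which it last entered
   (None if it has not moved), and whiteboard contents. *)
record ('id, 'lab, 's, 'w) view =
  my_id :: 'id
  my_state :: 's
  peers :: "'id \<Rightarrow> 's option"
  links :: "'lab set"
  entry :: "'lab option"
  board :: 'w

(* Gossip information is opaque: an algorithm cannot inspect it and only decides whether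
   to write all that the acting agent has collected to the whiteboard, erase the gossip
   stored there, or leave it untouched. *)
datatype gossip_write = Post | Erase | Leave

record ('lab, 's, 'w) act =
  new_state :: 's
  new_board :: 'w
  gossip_act :: gossip_write
  move :: "'lab option"

type_synonym ('id, 'lab, 's, 'w) algorithm =
  "('id, 'lab, 's, 'w) view \<Rightarrow> ('lab, 's, 'w) act"

(* Gossip pieces are natural numbers.  known c p is the set of pieces agent p has obtained
   so far, posted c v the set of pieces stored on the whiteboard of v. *)
record ('id, 'lab, 's, 'w) config =
  loc :: "'id \<Rightarrow> nat"
  state :: "'id \<Rightarrow> 's"
  came :: "'id \<Rightarrow> 'lab option"
  known :: "'id \<Rightarrow> nat set"
  wb :: "nat \<Rightarrow> 'w"
  posted :: "nat \<Rightarrow> nat set"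

(* I is the set of identifiers of the agents present, and g p the initial piece of gossip
   of p.  Apart from each agent having its own piece, everything is arbitrary. *)
definition initial ::
  "'lab network \<Rightarrow> 'id set \<Rightarrow> ('id \<Rightarrow> nat) \<Rightarrow> ('id, 'lab, 's, 'w) config \<Rightarrow> bool" where
  "initial G I g c \<longleftrightarrow>
     (\<forall>p\<in>I. loc c p \<in> nodes G \<and>
            (\<forall>a. came c p = Some a \<longrightarrow> a \<in> ports G (loc c p)) \<and>
            g p \<in> known c p)"

definition view_of ::
  "'lab network \<Rightarrow> 'id set \<Rightarrow> ('id, 'lab, 's, 'w) config \<Rightarrow> 'id \<Rightarrow> ('id, 'lab, 's, 'w) view" where
  "view_of G I c p =
     \<lparr> my_id = p, my_state = state c p,
       peers = (\<lambda>q. if q \<in> I \<and> q \<noteq> p \<and> loc c q = loc c p then Some (state c q) else None),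
       links = ports G (loc c p), entry = came c p, board = wb c (loc c p) \<rparr>"

definition collected ::
  "'id set \<Rightarrow> ('id, 'lab, 's, 'w) config \<Rightarrow> 'id \<Rightarrow> nat set" where
  "collected I c p =
     known c p \<union> posted c (loc c p) \<union> (\<Union>q\<in>{q \<in> I. loc c q = loc c p}. known c q)"

definition write_gossip :: "gossip_write \<Rightarrow> nat set \<Rightarrow> nat set \<Rightarrow> nat set" where
  "write_gossip x new old = (case x of Post \<Rightarrow> new | Erase \<Rightarrow> {} | Leave \<Rightarrow> old)"

(* A requested label that is not a local link label makes the agent stay. *)
definition heads_for ::
  "('id, 'lab, 's, 'w) algorithm \<Rightarrow> 'lab network \<Rightarrow> 'id set \<Rightarrow>
   ('id, 'lab, 's, 'w) config \<Rightarrow> 'id \<Rightarrow> nat \<Rightarrow> bool" where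
  "heads_for A G I c p v \<longleftrightarrow>
     (loc c p, v) \<in> adj G \<and> move (A (view_of G I c p)) = Some (lab G (loc c p) v)"

definition opposed ::
  "('id, 'lab, 's, 'w) algorithm \<Rightarrow> 'lab network \<Rightarrow> 'id set \<Rightarrow>
   ('id, 'lab, 's, 'w) config \<Rightarrow> 'id \<Rightarrow> 'id \<Rightarrow> bool" where
  "opposed A G I c p q \<longleftrightarrow> heads_for A G I c p (loc c q) \<and> heads_for A G I c q (loc c p)"

(* S: the agents acting simultaneously; M: those whose attempted move succeeds. Over a
   half-duplex link exactly one of two opposed attempts succeeds. *)
definition movers ::
  "link_model \<Rightarrow> ('id, 'lab, 's, 'w) algorithm \<Rightarrow> 'lab network \<Rightarrow> 'id set \<Rightarrow>
   ('id, 'lab, 's, 'w) config \<Rightarrow> 'id set \<Rightarrow> 'id set \<Rightarrow> bool" where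
  "movers lm A G I c S M \<longleftrightarrow>
     (let T = {p \<in> S. \<exists>v. heads_for A G I c p v} in
      case lm of
        Full_Duplex \<Rightarrow> M = T
      | Half_Duplex \<Rightarrow>
          M \<subseteq> T \<and> (\<forall>p\<in>T. p \<in> M \<longleftrightarrow> (\<forall>q\<in>S. opposed A G I c p q \<longrightarrow> q \<notin> M)))"

(* Simultaneously acting agents are at distinct nodes.  An agent that loses the competition
   for a half-duplex link still updates its state and the whiteboard, but stays. *)
definition step ::
  "link_model \<Rightarrow> ('id, 'lab, 's, 'w) algorithm \<Rightarrow> 'lab network \<Rightarrow> 'id set \<Rightarrow>
   'id set \<Rightarrow> ('id, 'lab, 's, 'w) config \<Rightarrow> ('id, 'lab, 's, 'w) config \<Rightarrow> bool" where
  "step lm A G I S c c' \<longleftrightarrow>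
     S \<subseteq> I \<and> inj_on (loc c) S \<and>
     (\<exists>M. movers lm A G I c S M \<and>
       (\<forall>p\<in>M. heads_for A G I c p (loc c' p) \<and>
              came c' p = Some (lab G (loc c' p) (loc c p))) \<and>
       (\<forall>p\<in>I - M. loc c' p = loc c p \<and> came c' p = came c p)) \<and>
     (\<forall>p\<in>S. let a = A (view_of G I c p) in
        state c' p = new_state a \<and>
        known c' p = collected I c p \<and>
        wb c' (loc c p) = new_board a \<and>
        posted c' (loc c p) =
          write_gossip (gossip_act a) (collected I c p) (posted c (loc c p))) \<and>
     (\<forall>p\<in>I - S. state c' p = state c p \<and> known c' p = known c p) \<and>
     (\<forall>v. v \<notin> loc c ` S \<longrightarrow> wb c' v = wb c v \<and> posted c' v = posted c v)"

(* Asynchrony: the sets of acting agents are arbitrary, except that each agent acts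
   infinitely often. *)
definition execution ::
  "link_model \<Rightarrow> ('id, 'lab, 's, 'w) algorithm \<Rightarrow> 'lab network \<Rightarrow> 'id set \<Rightarrow>
   ('id \<Rightarrow> nat) \<Rightarrow> (nat \<Rightarrow> ('id, 'lab, 's, 'w) config) \<Rightarrow> bool" where
  "execution lm A G I g C \<longleftrightarrow>
     is_network G \<and> finite I \<and> initial G I g (C 0) \<and>
     (\<exists>S. (\<forall>t. step lm A G I (S t) (C t) (C (Suc t))) \<and>
          (\<forall>p\<in>I. \<forall>t. \<exists>t'\<ge>t. p \<in> S t'))"

definition self_stabilizing_gossip ::
  "link_model \<Rightarrow> ('id, 'lab, 's, 'w) algorithm \<Rightarrow> bool" where
  "self_stabilizing_gossip lm A \<longleftrightarrow>
     (\<forall>G I g C. execution lm A G I g C \<longrightarrow> (\<forall>p\<in>I. \<exists>t. g ` I \<subseteq> known (C t) p))"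

(* Networks have no self-loops, so a constant location means that the agent never moves. *)
definition quiescent ::
  "link_model \<Rightarrow> nat \<Rightarrow> nat \<Rightarrow> ('id, 'lab, 's, 'w) algorithm \<Rightarrow> bool" where
  "quiescent lm k l A \<longleftrightarrow>
     (\<forall>G I g C. execution lm A G I g C \<and> card I = k \<longrightarrow>
        (\<exists>t. \<exists>R\<subseteq>I. l \<le> card R \<and> (\<forall>t'\<ge>t. \<forall>p\<in>R. loc (C t') p = loc (C t) p)))"

definition solvable ::
  "('id, 'lab, 's, 'w) algorithm itself \<Rightarrow> link_model \<Rightarrow> nat \<Rightarrow> nat \<Rightarrow> bool" where
  "solvable _ lm k l \<longleftrightarrow>
     (\<exists>A :: ('id, 'lab, 's, 'w) algorithm. self_stabilizing_gossip lm A \<and> quiescent lm k l A)"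

definition quiescence_number ::
  "('id, 'lab, 's, 'w) algorithm itself \<Rightarrow> link_model \<Rightarrow> nat \<Rightarrow> int" where
  "quiescence_number T lm k =
     (if solvable T lm k 0 then int (GREATEST l. solvable T lm k l) else - 1)"

end

theory Submission
  imports Defs "HOL-Library.Countable_Set" "HOL-Library.Nat_Bijection"
begin

text \<open>
  Possibility: all agents share rotor-router pointers stored on the whiteboards and always post
  what they have collected. A node at which infinitely many actions take place attempts every
  link infinitely often, so activity and gossip both spread along links.

  Impossibility: take the network with two nodes whose links all carry the same label. If an
  algorithm is \<open>l\<close>-quiescent with \<open>l \<ge> 1\<close>, some reachable configuration has a group of
  agents at a node that never leaves as long as only its members act, since otherwise a
  scheduler could make every agent move infinitely often. Two such groups with disjoint
  identifiers, one at each node, never meet.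
\<close>

section \<open>Fair enumerations and counters that skip no value\<close>

text \<open>Only the first component of the decoded pair selects an element; the free second
  component makes each element recur at arbitrarily large indices.\<close>

definition fair_enum :: "'a set \<Rightarrow> nat \<Rightarrow> 'a" where
  "fair_enum A n = from_nat_into A (fst (prod_decode n))"

lemma fair_enum_in: "A \<noteq> {} \<Longrightarrow> fair_enum A n \<in> A"
  by (simp add: fair_enum_def from_nat_into)

lemma fair_enum_frequently:
  assumes "countable A" "x \<in> A"
  shows "\<exists>n\<ge>m. fair_enum A n = x"
proof -
  obtain i where "from_nat_into A i = x"
    using from_nat_into_surj[OF assms] by blast
  then have "fair_enum A (prod_encode (i, m)) = x"
    by (simp add: fair_enum_def)
  then show ?thesis
    using le_prod_encode_2 by blast
qed

lemma counter_next_tick: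
  fixes f :: "nat \<Rightarrow> nat"
  assumes step: "\<And>t. f (Suc t) = (if Q t then Suc (f t) else f t)"
    and often: "\<And>t. \<exists>t'\<ge>t. Q t'"
  shows "\<exists>t'\<ge>t. Q t' \<and> f t' = f t"
proof -
  define t1 where "t1 = (LEAST t'. t \<le> t' \<and> Q t')"
  have t1: "t \<le> t1 \<and> Q t1"
    unfolding t1_def using often[of t] LeastI_ex[of "\<lambda>t'. t \<le> t' \<and> Q t'"] by blast
  have idle: "\<not> Q s" if "t \<le> s" "s < t1" for s
    using not_less_Least[of s "\<lambda>t'. t \<le> t' \<and> Q t'"] that unfolding t1_def by blast
  have "s \<le> t1 \<longrightarrow> f s = f t" if "t \<le> s" for s
    using that by (induction s rule: dec_induct) (auto simp: step idle)
  then show ?thesis using t1 by blast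
qed

text \<open>The counter grows by one at each tick and only then, so it passes through every later
  value, and a tick occurs while it shows that value.\<close>

lemma counter_hits:
  fixes f :: "nat \<Rightarrow> nat"
  assumes step: "\<And>t. f (Suc t) = (if Q t then Suc (f t) else f t)"
    and often: "\<And>t. \<exists>t'\<ge>t. Q t'"
    and "f t \<le> N"
  shows "\<exists>t'\<ge>t. Q t' \<and> f t' = N"
  using \<open>f t \<le> N\<close>
proof (induction N rule: dec_induct)
  case base
  show ?case using counter_next_tick[of f Q, OF step often] by blast
next
  case (step n)
  then obtain t1 where t1: "t \<le> t1" "Q t1" "f t1 = n" by blast
  then have "f (Suc t1) = Suc n" using assms(1) by simp
  then show ?case
    using counter_next_tick[of f Q "Suc t1", OF assms(1) often] t1(1)
    by (metis Suc_leD le_trans)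
qed

section \<open>Steps of an arbitrary algorithm\<close>

lemma network_adjD:
  assumes "is_network G" "(u, v) \<in> adj G"
  shows "u \<in> nodes G" "v \<in> nodes G"
  using assms unfolding is_network_def by blast+

lemma network_finite: "is_network G \<Longrightarrow> finite (nodes G)"
  by (simp add: is_network_def)

lemma network_connected:
  "is_network G \<Longrightarrow> u \<in> nodes G \<Longrightarrow> v \<in> nodes G \<Longrightarrow> (u, v) \<in> (adj G)\<^sup>*"
  by (simp add: is_network_def)

lemma network_inj_lab: "is_network G \<Longrightarrow> u \<in> nodes G \<Longrightarrow> inj_on (lab G u) (adj G `` {u})"
  by (simp add: is_network_def)

lemma heads_for_unique:
  assumes "is_network G" "heads_for A G I c p v" "heads_for A G I c p w"
  shows "v = w"
proof -
  have "inj_on (lab G (loc c p)) (adj G `` {loc c p})"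
    using assms(2) network_inj_lab[OF assms(1)] network_adjD(1)[OF assms(1)]
    unfolding heads_for_def by blast
  then show ?thesis
    using assms(2,3) by (auto simp: heads_for_def inj_on_def)
qed

lemma movers_subset: "movers lm A G I c S M \<Longrightarrow> M \<subseteq> S"
  by (auto simp: movers_def Let_def split: link_model.splits)

lemma step_movers:
  assumes "step lm A G I S c c'"
  obtains M where "movers lm A G I c S M"
    "\<And>p. p \<in> M \<Longrightarrow> heads_for A G I c p (loc c' p)"
    "\<And>p. p \<in> I \<Longrightarrow> p \<notin> M \<Longrightarrow> loc c' p = loc c p"
proof -
  have "\<exists>M. movers lm A G I c S M \<and>
      (\<forall>p\<in>M. heads_for A G I c p (loc c' p) \<and>
             came c' p = Some (lab G (loc c' p) (loc c p))) \<and>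
      (\<forall>p\<in>I - M. loc c' p = loc c p \<and> came c' p = came c p)"
    using assms unfolding step_def by (elim conjE)
  then show ?thesis using that by auto
qed

lemma step_idle:
  assumes "step lm A G I S c c'" "p \<in> I" "p \<notin> S"
  shows "loc c' p = loc c p" "known c' p = known c p"
proof -
  obtain M where "movers lm A G I c S M" "\<And>p. p \<in> I \<Longrightarrow> p \<notin> M \<Longrightarrow> loc c' p = loc c p"
    using step_movers[OF assms(1)] by metis
  then show "loc c' p = loc c p" using movers_subset assms(2,3) by blast
  show "known c' p = known c p" using assms by (simp add: step_def)
qed

lemma step_known:
  assumes "step lm A G I S c c'" "p \<in> S"
  shows "known c' p = collected I c p"
  using assms by (simp add: step_def Let_def)

lemma step_known_mono:
  assumes "step lm A G I S c c'" "p \<in> I"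
  shows "known c p \<subseteq> known c' p"
  using step_idle(2)[OF assms] step_known[OF assms(1), of p]
  by (cases "p \<in> S") (auto simp: collected_def)

lemma step_loc_nodes:
  assumes "is_network G" "step lm A G I S c c'" "p \<in> I" "loc c p \<in> nodes G"
  shows "loc c' p \<in> nodes G"
proof -
  obtain M where M: "\<And>p. p \<in> M \<Longrightarrow> heads_for A G I c p (loc c' p)"
      "\<And>p. p \<in> I \<Longrightarrow> p \<notin> M \<Longrightarrow> loc c' p = loc c p"
    using step_movers[OF assms(2)] by metis
  show ?thesis
  proof (cases "p \<in> M")
    case True
    then have "(loc c p, loc c' p) \<in> adj G" using M(1)[OF True] by (simp add: heads_for_def)
    then show ?thesis by (rule network_adjD(2)[OF assms(1)])
  next
    case False
    then have "loc c' p = loc c p" using M(2) assms(3) by blast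
    then show ?thesis using assms(4) by simp
  qed
qed

text \<open>An attempt can fail only against a successful opponent, which then arrives at the node
  of \<open>p\<close>. After this lemma the possibility argument no longer distinguishes the two
  link models.\<close>

lemma step_attempt:
  assumes net: "is_network G" and st: "step lm A G I S c c'"
    and p: "p \<in> S" "heads_for A G I c p v"
  shows "loc c' p = v \<or> (\<exists>q\<in>S. loc c q = v \<and> loc c' q = loc c p)"
proof -
  obtain M where mov: "movers lm A G I c S M"
    and M: "\<And>p. p \<in> M \<Longrightarrow> heads_for A G I c p (loc c' p)"
    using step_movers[OF st] by metis
  show ?thesis
  proof (cases "p \<in> M")
    case True
    then show ?thesis using heads_for_unique[OF net M p(2)] by blast
  next
    case False
    \<comment> \<open>Full duplex is excluded here, since \<open>M\<close> would then contain every
      attempting agent.\<close>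
    then obtain q where q: "q \<in> S" "opposed A G I c p q" "q \<in> M"
      using mov p by (auto simp: movers_def Let_def split: link_model.splits)
    then show ?thesis
      using heads_for_unique[OF net M[of q]] heads_for_unique[OF net p(2)]
      unfolding opposed_def by metis
  qed
qed

section \<open>The rotor-router algorithm\<close>

text \<open>The whiteboard type is an arbitrary infinite type, so a counter is stored through some
  injection from the naturals.\<close>

definition enc :: "nat \<Rightarrow> 'w::infinite" where
  "enc = (SOME f. inj f)"

text \<open>As a total function it reads a counter from arbitrary initial contents too, as
  self-stabilization demands.\<close>

definition dec :: "'w::infinite \<Rightarrow> nat" where
  "dec = inv enc"

lemma dec_enc [simp]: "dec (enc n :: 'w::infinite) = n"
proof -
  have "\<exists>f :: nat \<Rightarrow> 'w. inj f"
    using infinite_countable_subset[OF infinite_class.infinite_UNIV] by auto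
  then have "inj (enc :: nat \<Rightarrow> 'w)"
    unfolding enc_def by (rule someI_ex)
  then show ?thesis by (simp add: dec_def)
qed

text \<open>The link depends on the ports and the whiteboard alone, so all agents visiting a node
  drive one common rotor. At a node without links the requested label is not local, and the agent
  stays.\<close>

definition rotor :: "('id, 'lab, 's, 'w::infinite) algorithm" where
  "rotor x = \<lparr> new_state = my_state x, new_board = enc (Suc (dec (board x))),
     gossip_act = Post, move = Some (fair_enum (links x) (dec (board x))) \<rparr>"

text \<open>Acting agents are at distinct nodes, so a counter ticks at most once per step. It ticks
  even when the attempted crossing fails, because the loser still writes.\<close>

lemma rotor_board:
  assumes "step lm rotor G I S c c'"
  shows "dec (wb c' v) = (if v \<in> loc c ` S then Suc (dec (wb c v)) else dec (wb c v))"
  using assms unfolding step_def by (auto simp: rotor_def Let_def view_of_def)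

lemma rotor_posted:
  assumes "step lm rotor G I S c c'" "p \<in> S"
  shows "posted c' (loc c p) = collected I c p"
  using assms unfolding step_def by (auto simp: rotor_def Let_def write_gossip_def)

lemma rotor_posted_mono:
  assumes "step lm rotor G I S c c'"
  shows "posted c v \<subseteq> posted c' v"
proof (cases "v \<in> loc c ` S")
  case True
  then show ?thesis using rotor_posted[OF assms] by (auto simp: collected_def)
next
  case False
  then show ?thesis using assms by (simp add: step_def)
qed

section \<open>Spreading of activity and gossip in rotor-router executions\<close>

locale rotor_execution =
  fixes lm :: link_model and G :: "'lab network" and I :: "'id set" and g
    and C :: "nat \<Rightarrow> ('id, 'lab, 's, 'w::infinite) config" and S
  assumes net: "is_network G" and fin: "finite I" and init: "initial G I g (C 0)"
    and steps: "\<And>t. step lm rotor G I (S t) (C t) (C (Suc t))"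
    and fair: "\<And>p t. p \<in> I \<Longrightarrow> \<exists>t'\<ge>t. p \<in> S t'"
begin

lemma S_subset: "p \<in> S t \<Longrightarrow> p \<in> I"
  using steps[of t] by (auto simp: step_def)

lemma loc_nodes: "p \<in> I \<Longrightarrow> loc (C t) p \<in> nodes G"
  by (induction t) (use init step_loc_nodes[OF net steps] in \<open>auto simp: initial_def\<close>)

lemma known_mono: "t \<le> t' \<Longrightarrow> p \<in> I \<Longrightarrow> known (C t) p \<subseteq> known (C t') p"
  by (induction t' rule: dec_induct) (use step_known_mono[OF steps] in blast)+

lemma posted_mono: "t \<le> t' \<Longrightarrow> posted (C t) v \<subseteq> posted (C t') v"
  by (induction t' rule: dec_induct) (use rotor_posted_mono[OF steps] in blast)+

text \<open>Only acting agents move, so at its first action from time \<open>t\<close> on the agent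
  is still where it was at \<open>t\<close>.\<close>

lemma next_act:
  assumes "p \<in> I"
  obtains t' where "t \<le> t'" "p \<in> S t'" "loc (C t') p = loc (C t) p"
proof -
  define t1 where "t1 = (LEAST t'. t \<le> t' \<and> p \<in> S t')"
  have t1: "t \<le> t1 \<and> p \<in> S t1"
    unfolding t1_def using fair[OF assms, of t] LeastI_ex[of "\<lambda>t'. t \<le> t' \<and> p \<in> S t'"] by blast
  have idle: "p \<notin> S s" if "t \<le> s" "s < t1" for s
    using not_less_Least[of s "\<lambda>t'. t \<le> t' \<and> p \<in> S t'"] that unfolding t1_def by blast
  have "s \<le> t1 \<longrightarrow> loc (C s) p = loc (C t) p" if "t \<le> s" for s
    using that
    by (induction s rule: dec_induct) (auto simp: step_idle(1)[OF steps assms idle])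
  then show ?thesis using that t1 by blast
qed

definition active :: "nat \<Rightarrow> nat \<Rightarrow> bool" where
  "active v t \<longleftrightarrow> v \<in> loc (C t) ` S t"

text \<open>The counter of \<open>u\<close> reaches every value above its current one during some
  action at \<open>u\<close>, and the enumeration yields the label of the link to \<open>v\<close>
  at arbitrarily large values.\<close>

lemma attempts_frequently:
  assumes "\<And>t. \<exists>t'\<ge>t. active u t'" and "(u, v) \<in> adj G"
  obtains t' p where "t \<le> t'" "p \<in> S t'" "loc (C t') p = u" "heads_for rotor G I (C t') p v"
proof -
  let ?f = "\<lambda>t. dec (wb (C t) u)"
  have "finite (adj G)"
    using network_finite[OF net] network_adjD[OF net]
    by (intro finite_subset[of "adj G" "nodes G \<times> nodes G"]) auto
  then have countable: "countable (ports G u)"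
    unfolding ports_def by (intro countable_image countable_finite finite_Image)
  have "lab G u v \<in> ports G u"
    using assms(2) by (auto simp: ports_def)
  from fair_enum_frequently[OF countable this, of "?f t"]
  obtain N where N: "?f t \<le> N" "fair_enum (ports G u) N = lab G u v"
    by blast
  have "?f (Suc t) = (if active u t then Suc (?f t) else ?f t)" for t
    using rotor_board[OF steps] by (simp add: active_def)
  from counter_hits[of ?f "active u", OF this assms(1) N(1)]
  obtain t' where "t \<le> t'" "active u t'" "?f t' = N" by blast
  then show ?thesis
    using that N(2) assms(2) by (auto simp: active_def heads_for_def rotor_def view_of_def)
qed

lemma active_frequently:
  assumes "I \<noteq> {}" "v \<in> nodes G"
  shows "\<exists>t'\<ge>t. active v t'"
proof -
  \<comment> \<open>Pigeonhole: if each of the finitely many nodes were eventually inactive, no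
    agent would act any more.\<close>
  have "\<exists>u\<in>nodes G. \<forall>t. \<exists>t'\<ge>t. active u t'"
  proof (rule ccontr)
    assume "\<not> ?thesis"
    then have "\<forall>u\<in>nodes G. \<forall>\<^sub>F t in sequentially. \<not> active u t"
      by (auto simp: eventually_sequentially)
    then have "\<forall>\<^sub>F t in sequentially. \<forall>u\<in>nodes G. \<not> active u t"
      using network_finite[OF net] by (simp add: eventually_ball_finite)
    then obtain t0 where t0: "\<And>t u. t0 \<le> t \<Longrightarrow> u \<in> nodes G \<Longrightarrow> \<not> active u t"
      by (auto simp: eventually_sequentially)
    obtain p where "p \<in> I" using assms(1) by blast
    then obtain t1 where "t0 \<le> t1" "p \<in> S t1" using fair by blast
    then show False using t0 loc_nodes[OF \<open>p \<in> I\<close>] by (auto simp: active_def)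
  qed
  then obtain u where u: "u \<in> nodes G" "\<forall>t. \<exists>t'\<ge>t. active u t'" by blast
  have "(u, v) \<in> (adj G)\<^sup>*"
    by (rule network_connected[OF net u(1) assms(2)])
  then have "\<forall>t. \<exists>t'\<ge>t. active v t'"
  proof (induction rule: rtrancl_induct)
    case base
    show ?case by (rule u(2))
  next
    case (step y z)
    show ?case
    proof (rule ccontr)
      assume "\<not> ?thesis"
      then obtain t0 where t0: "\<And>t. t0 \<le> t \<Longrightarrow> \<not> active z t" by blast
      obtain t p where t: "t0 \<le> t" "p \<in> S t" "heads_for rotor G I (C t) p z"
        using attempts_frequently step by metis
      \<comment> \<open>No opponent acts at the inactive node \<open>z\<close>, so the attempt
        succeeds; the next action of \<open>p\<close> then takes place at \<open>z\<close>.\<close>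
      have "loc (C (Suc t)) p = z"
        using step_attempt[OF net steps t(2,3)] t0[OF t(1)] by (auto simp: active_def)
      then obtain t' where "Suc t \<le> t'" "p \<in> S t'" "loc (C t') p = z"
        using next_act S_subset t(2) by metis
      then show False using t0[of t'] t(1) by (auto simp: active_def)
    qed
  qed
  then show ?thesis by blast
qed

text \<open>A failed attempt to carry the piece \<open>x\<close> from \<open>u\<close> to \<open>v\<close> over a half-duplex
  link lets an agent ignorant of \<open>x\<close> enter \<open>u\<close>, where it learns \<open>x\<close>; this happens at
  most once for each agent.\<close>

lemma posted_spreads:
  assumes "I \<noteq> {}" and x: "x \<in> posted (C t0) u" and uv: "(u, v) \<in> adj G"
  shows "\<exists>t. x \<in> posted (C t) v"
proof (rule ccontr)
  assume "\<not> ?thesis"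
  then have no: "x \<notin> posted (C t) v" for t by blast
  define K where "K t = {p \<in> I. x \<in> known (C t) p}" for t
  have "card (K t) \<le> card I" for t
    unfolding K_def by (rule card_mono) (use fin in auto)
  then have "\<forall>t. t0 \<le> t \<longrightarrow> card (K t) < Suc (card I)" by (simp add: less_Suc_eq_le)
  \<comment> \<open>The number of agents knowing \<open>x\<close> is bounded by
    \<open>card I\<close>, hence maximal at some \<open>t1\<close>; after \<open>t1\<close> no agent
    newly learns \<open>x\<close>.\<close>
  from ex_has_greatest_nat[of "\<lambda>t. t0 \<le> t" t0 "\<lambda>t. card (K t)", OF order_refl this]
  obtain t1 where t1: "t0 \<le> t1" "\<And>t. t0 \<le> t \<Longrightarrow> card (K t) \<le> card (K t1)" by blast
  have stable: "K t = K t1" if "t1 \<le> t" for t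
  proof (rule card_seteq[symmetric])
    show "finite (K t)" using fin by (simp add: K_def)
    show "K t1 \<subseteq> K t" using known_mono[OF that] by (auto simp: K_def)
    show "card (K t) \<le> card (K t1)" using t1 that by simp
  qed
  have "u \<in> nodes G" by (rule network_adjD(1)[OF net uv])
  from attempts_frequently[OF active_frequently[OF assms(1) this] uv]
  obtain t p where t: "t1 \<le> t" "p \<in> S t" "loc (C t) p = u" "heads_for rotor G I (C t) p v"
    by blast
  have xu: "x \<in> posted (C s) u" if "t1 \<le> s" for s
    using posted_mono[of t0 s u] x t1(1) that by auto
  from step_attempt[OF net steps t(2,4)] show False
  proof
    assume "loc (C (Suc t)) p = v"
    then obtain t' where t': "Suc t \<le> t'" "p \<in> S t'" "loc (C t') p = v"
      using next_act S_subset t(2) by metis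
    have "x \<in> known (C (Suc t)) p"
      using step_known[OF steps t(2)] xu[OF t(1)] t(3) by (auto simp: collected_def)
    then have "x \<in> known (C t') p"
      using known_mono[OF t'(1)] S_subset[OF t(2)] by blast
    then have "x \<in> posted (C (Suc t')) v"
      using rotor_posted[OF steps t'(2)] t'(3) by (auto simp: collected_def)
    then show False using no by blast
  next
    assume "\<exists>q\<in>S t. loc (C t) q = v \<and> loc (C (Suc t)) q = loc (C t) p"
    then obtain q where q: "q \<in> S t" "loc (C t) q = v" "loc (C (Suc t)) q = u"
      using t(3) by blast
    \<comment> \<open>When acting at \<open>v\<close>, the agent \<open>q\<close> posts there
      everything it then knows, and \<open>x\<close> never appears at \<open>v\<close>.\<close>
    have "x \<notin> known (C (Suc t)) q"
      using no[of "Suc t"] rotor_posted[OF steps q(1)] step_known[OF steps q(1)] q(2) by simp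
    then have ignorant: "q \<notin> K (Suc t)" by (simp add: K_def)
    obtain t' where t': "Suc t \<le> t'" "q \<in> S t'" "loc (C t') q = u"
      using next_act S_subset q(1,3) by metis
    have "x \<in> known (C (Suc t')) q"
      using step_known[OF steps t'(2)] xu[of t'] t(1) t'(1,3) by (auto simp: collected_def)
    then have "q \<in> K (Suc t')" using S_subset q(1) by (simp add: K_def)
    then show False
      using ignorant stable[of "Suc t"] stable[of "Suc t'"] t(1) t'(1) by simp
  qed
qed

lemma piece_known_eventually:
  assumes "p \<in> I" "r \<in> I"
  shows "\<forall>\<^sub>F t in sequentially. g r \<in> known (C t) p"
proof -
  have "I \<noteq> {}" using assms by blast
  obtain s where s: "r \<in> S s" using fair[OF assms(2), of 0] by blast
  let ?u = "loc (C s) r"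
  have "g r \<in> known (C s) r"
    using init known_mono[OF _ assms(2), of 0 s] assms(2) unfolding initial_def by blast
  then have start: "g r \<in> posted (C (Suc s)) ?u"
    using rotor_posted[OF steps s] by (auto simp: collected_def)
  have "\<forall>\<^sub>F t in sequentially. g r \<in> posted (C t) v" if "v \<in> nodes G" for v
  proof -
    have "(?u, v) \<in> (adj G)\<^sup>*"
      by (rule network_connected[OF net loc_nodes[OF assms(2)] that])
    then have "\<exists>t. g r \<in> posted (C t) v"
      by (induction rule: rtrancl_induct) (use start posted_spreads[OF \<open>I \<noteq> {}\<close>] in blast)+
    then show ?thesis
      using posted_mono unfolding eventually_sequentially by blast
  qed
  then have "\<forall>\<^sub>F t in sequentially. \<forall>v\<in>nodes G. g r \<in> posted (C t) v"
    using network_finite[OF net] by (simp add: eventually_ball_finite)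
  then obtain t0 where t0: "\<And>t v. t0 \<le> t \<Longrightarrow> v \<in> nodes G \<Longrightarrow> g r \<in> posted (C t) v"
    by (auto simp: eventually_sequentially)
  obtain t where t: "t0 \<le> t" "p \<in> S t" using fair[OF assms(1)] by blast
  have "g r \<in> known (C (Suc t)) p"
    using step_known[OF steps t(2)] t0[OF t(1) loc_nodes[OF assms(1)]]
    by (auto simp: collected_def)
  then show ?thesis
    using known_mono[OF _ assms(1)] unfolding eventually_sequentially by blast
qed

end

lemma rotor_self_stabilizing:
  "self_stabilizing_gossip lm (rotor :: ('id, 'lab, 's, 'w::infinite) algorithm)"
  unfolding self_stabilizing_gossip_def
proof (intro allI impI ballI)
  fix G I g and C :: "nat \<Rightarrow> ('id, 'lab, 's, 'w) config" and p
  assume "execution lm rotor G I g C" and p: "p \<in> I"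
  then obtain S where "rotor_execution lm G I g C S"
    unfolding execution_def rotor_execution_def by blast
  then interpret rotor_execution lm G I g C S .
  have "\<forall>\<^sub>F t in sequentially. \<forall>r\<in>I. g r \<in> known (C t) p"
    using fin piece_known_eventually[OF p] by (auto intro: eventually_ball_finite)
  then show "\<exists>t. g ` I \<subseteq> known (C t) p"
    by (auto simp: eventually_sequentially)
qed

section \<open>Agents on the network with two nodes\<close>

text \<open>A single label, used at both ends, makes the two nodes look alike to agents; each node
  has one link, so labels remain locally distinct.\<close>

definition pair_net :: "'lab \<Rightarrow> 'lab network" where
  "pair_net a = \<lparr> nodes = {0, 1}, adj = {(0, 1), (1, 0)}, lab = (\<lambda>_ _. a) \<rparr>"

lemma pair_net_network: "is_network (pair_net a)"
proof -
  have "(0, 1) \<in> {(0::nat, 1::nat), (1, 0)}\<^sup>*" "(1, 0) \<in> {(0::nat, 1::nat), (1, 0)}\<^sup>*"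
    by (auto intro: r_into_rtrancl)
  then show ?thesis
    by (auto simp: is_network_def pair_net_def sym_def irrefl_def inj_on_def)
qed

lemma pair_net_ports: "u \<in> {0, 1} \<Longrightarrow> ports (pair_net a) u = {a}"
  by (auto simp: ports_def pair_net_def)

lemma pair_net_lab: "lab (pair_net a) u v = a"
  by (simp add: pair_net_def)

definition valid :: "'lab \<Rightarrow> 'id set \<Rightarrow> ('id, 'lab, 's, 'w) config \<Rightarrow> bool" where
  "valid a I c \<longleftrightarrow> (\<forall>p\<in>I. loc c p \<in> {0, 1} \<and> came c p \<in> {None, Some a})"

definition departs ::
  "('id, 'lab, 's, 'w) algorithm \<Rightarrow> 'lab \<Rightarrow> 'id set \<Rightarrow> ('id, 'lab, 's, 'w) config \<Rightarrow> 'id \<Rightarrow> bool"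
  where "departs A a I c p \<longleftrightarrow> move (A (view_of (pair_net a) I c p)) = Some a"

text \<open>Resolving \<open>step\<close> into a function for a single acting agent allows schedules
  to be defined by recursion. On the nodes 0 and 1, \<open>1 - loc c p\<close> is the other
  node.\<close>

definition solo ::
  "('id, 'lab, 's, 'w) algorithm \<Rightarrow> 'lab \<Rightarrow> 'id set \<Rightarrow> ('id, 'lab, 's, 'w) config \<Rightarrow> 'id \<Rightarrow>
   ('id, 'lab, 's, 'w) config" where
  "solo A a I c p = (let x = A (view_of (pair_net a) I c p) in
     \<lparr> loc = (if departs A a I c p then (loc c)(p := 1 - loc c p) else loc c),
       state = (state c)(p := new_state x),
       came = (if departs A a I c p then (came c)(p := Some a) else came c),
       known = (known c)(p := collected I c p),
       wb = (wb c)(loc c p := new_board x),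
       posted = (posted c)(loc c p :=
         write_gossip (gossip_act x) (collected I c p) (posted c (loc c p))) \<rparr>)"

lemma solo_valid: "valid a I c \<Longrightarrow> p \<in> I \<Longrightarrow> valid a I (solo A a I c p)"
  by (auto simp: valid_def solo_def Let_def)

text \<open>A lone actor has no opponent, so its attempt succeeds under either link model.\<close>

lemma solo_step:
  assumes "valid a I c" "p \<in> I"
  shows "step lm A (pair_net a) I {p} c (solo A a I c p)"
proof -
  have "loc c p \<in> {0, 1}" using assms by (auto simp: valid_def)
  then have heads: "heads_for A (pair_net a) I c p v \<longleftrightarrow> departs A a I c p \<and> v = 1 - loc c p" for v
    by (auto simp: heads_for_def departs_def pair_net_def)
  have "movers lm A (pair_net a) I c {p} (if departs A a I c p then {p} else {})"
    using \<open>loc c p \<in> {0, 1}\<close>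
    by (auto simp: movers_def opposed_def heads split: link_model.splits)
  then show ?thesis
    unfolding step_def using assms(2)
    by (intro conjI exI[of _ "if departs A a I c p then {p} else {}"])
      (auto simp: heads solo_def Let_def pair_net_lab)
qed

lemma solo_execution:
  assumes "finite I" "valid a I (C 0)" "\<And>p. p \<in> I \<Longrightarrow> g p \<in> known (C 0) p"
    and "\<And>t. e t \<in> I" "\<And>t. C (Suc t) = solo A a I (C t) (e t)"
    and "\<And>p t. p \<in> I \<Longrightarrow> \<exists>t'\<ge>t. e t' = p"
  shows "execution lm A (pair_net a) I g C"
proof -
  have val: "valid a I (C t)" for t
    by (induction t) (simp_all add: assms(2,4,5) solo_valid)
  have "initial (pair_net a) I g (C 0)"
    using assms(2,3) unfolding initial_def valid_def
    by (auto simp: pair_net_ports) (auto simp: pair_net_def)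
  moreover have "step lm A (pair_net a) I {e t} (C t) (C (Suc t))" for t
    using solo_step[OF val assms(4)] assms(5) by simp
  moreover have "\<exists>t'\<ge>t. p \<in> {e t'}" if "p \<in> I" for p t
    using assms(6)[OF that, of t] by auto
  ultimately show ?thesis
    unfolding execution_def using assms(1) pair_net_network
    by (intro conjI exI[of _ "\<lambda>t. {e t}"] allI ballI) assumption+
qed

text \<open>In the configurations of \<open>Y\<close>, the agents of \<open>P\<close> share a node that no other agent occupies,
  and none of them leaves it as long as only agents of \<open>P\<close> act.\<close>

definition stuck ::
  "('id, 'lab, 's, 'w) algorithm \<Rightarrow> 'lab \<Rightarrow> 'id set \<Rightarrow> 'id set \<Rightarrow>
   ('id, 'lab, 's, 'w) config set \<Rightarrow> bool" where
  "stuck A a I P Y \<longleftrightarrow> P \<noteq> {} \<and> P \<subseteq> I \<and> Y \<noteq> {} \<and>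
     (\<forall>c\<in>Y. valid a I c \<and> (\<exists>v. P = {q \<in> I. loc c q = v}) \<and>
       (\<forall>q\<in>P. \<not> departs A a I c q \<and> solo A a I c q \<in> Y))"

text \<open>The number of preceding actions gives a scheduler a measure to decrease until
  \<open>p\<close> departs.\<close>

fun departs_after ::
  "('id, 'lab, 's, 'w) algorithm \<Rightarrow> 'lab \<Rightarrow> 'id set \<Rightarrow> 'id \<Rightarrow> nat \<Rightarrow>
   ('id, 'lab, 's, 'w) config \<Rightarrow> bool" where
  "departs_after A a I p 0 c = departs A a I c p"
| "departs_after A a I p (Suc n) c = (\<exists>q\<in>I. departs_after A a I p n (solo A a I c q))"

text \<open>Among the configurations from which \<open>p\<close> cannot be made to leave its node, those with the
  fewest agents around \<open>p\<close> cannot lose any of these agents.\<close>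

lemma stuck_exists:
  assumes "finite I" "valid a I c0" "p \<in> I" "\<And>n. \<not> departs_after A a I p n c0"
  shows "\<exists>P Y. stuck A a I P Y"
proof -
  define X where "X = {c. valid a I c \<and> (\<forall>n. \<not> departs_after A a I p n c)}"
  define grp where "grp c = {q \<in> I. loc c q = loc c p}" for c :: "('a, 'b, 'c, 'd) config"
  have X_valid: "valid a I c" and X_not: "\<not> departs_after A a I p n c" if "c \<in> X" for c n
    using that by (simp_all add: X_def)
  have X_solo: "solo A a I c q \<in> X" if "c \<in> X" "q \<in> I" for c q
  proof -
    have "\<not> departs_after A a I p n (solo A a I c q)" for n
      using X_not[OF that(1), of "Suc n"] that(2) by auto
    then show ?thesis
      using solo_valid[OF X_valid[OF that(1)] that(2)] by (simp add: X_def)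
  qed
  have X_p: "\<not> departs A a I c p" if "c \<in> X" for c
    using X_not[OF that, of 0] by simp
  have "c0 \<in> X" using assms by (simp add: X_def)
  then obtain c1 where c1: "c1 \<in> X" "\<And>c. c \<in> X \<Longrightarrow> card (grp c1) \<le> card (grp c)"
    using ex_has_least_nat[of "\<lambda>c. c \<in> X" c0 "\<lambda>c. card (grp c)"] by blast
  \<comment> \<open>The group itself is fixed and not only its size, because \<open>stuck\<close>
    asks for one \<open>P\<close> throughout \<open>Y\<close>.\<close>
  define Y where "Y = {c \<in> X. grp c = grp c1}"
  have stay: "\<not> departs A a I c q" if "c \<in> Y" "q \<in> grp c1" for c q
  proof
    assume dep: "departs A a I c q"
    have c: "c \<in> X" "grp c = grp c1" "q \<in> I" "loc c q = loc c p"
      using that by (auto simp: Y_def grp_def)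
    then have "q \<noteq> p" "loc c q \<in> {0, 1}"
      using dep X_p by (auto simp: X_def valid_def)
    then have "grp (solo A a I c q) = grp c - {q}"
      using dep c(4) by (auto simp: grp_def solo_def Let_def)
    moreover have "finite (grp c)" using assms(1) by (simp add: grp_def)
    ultimately have "card (grp (solo A a I c q)) < card (grp c1)"
      using that(2) c(2) by (metis card_Diff1_less)
    then show False using c1(2)[OF X_solo[OF c(1,3)]] by simp
  qed
  have "solo A a I c q \<in> Y" if "c \<in> Y" "q \<in> grp c1" for c q
  proof -
    have "loc (solo A a I c q) = loc c" using stay[OF that] by (simp add: solo_def Let_def)
    then show ?thesis using that X_solo[of c q] by (auto simp: Y_def grp_def)
  qed
  moreover have "p \<in> grp c1" "c1 \<in> Y" using assms(3) c1(1) by (auto simp: grp_def Y_def)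
  moreover have "valid a I c \<and> (\<exists>v. grp c1 = {q \<in> I. loc c q = v})" if "c \<in> Y" for c
    using that by (auto simp: Y_def X_def grp_def)
  ultimately have "stuck A a I (grp c1) Y"
    unfolding stuck_def using stay by (auto simp: grp_def)
  then show ?thesis by blast
qed

text \<open>Without stuck groups a scheduler can force each agent in turn to leave its node, by always choosing an
  action that brings the departure of the current target closer.\<close>

lemma quiescent_stuck:
  assumes q: "quiescent lm k l A" and "1 \<le> l" "finite I" "card I = k" "1 \<le> k"
  shows "\<exists>P Y. stuck A a I P Y"
proof (rule ccontr)
  assume "\<not> ?thesis"
  then have leave: "\<exists>n. departs_after A a I p n c" if "valid a I c" "p \<in> I" for c p
    using stuck_exists[OF assms(3) that] by blast
  have "I \<noteq> {}" using assms by auto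
  define e where "e = fair_enum I"
  have e: "e j \<in> I" for j unfolding e_def by (rule fair_enum_in[OF \<open>I \<noteq> {}\<close>])
  define d where "d p c = (LEAST n. departs_after A a I p n c)" for p c
  have d: "departs_after A a I p (d p c) c" if "valid a I c" "p \<in> I" for p c
    unfolding d_def by (rule LeastI_ex[OF leave[OF that]])
  \<comment> \<open>At distance 0 the target acts and departs; otherwise an agent is chosen whose
    action lowers the distance.\<close>
  define nxt where "nxt p c = (if d p c = 0 then p else
      (SOME q. q \<in> I \<and> departs_after A a I p (d p c - 1) (solo A a I c q)))" for p c
  have nxt: "nxt p c \<in> I \<and> departs_after A a I p (d p c - 1) (solo A a I c (nxt p c))"
    if "valid a I c" "p \<in> I" "d p c \<noteq> 0" for p c
  proof -
    have "\<exists>q. q \<in> I \<and> departs_after A a I p (d p c - 1) (solo A a I c q)"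
      using d[OF that(1,2)] that(3) by (cases "d p c") auto
    from someI_ex[OF this] show ?thesis unfolding nxt_def using that(3) by simp
  qed
  define c0 :: "('a, 'b, 'c, 'd) config" where
    "c0 = \<lparr> loc = (\<lambda>_. 0), state = undefined, came = (\<lambda>_. None), known = (\<lambda>_. {0}),
       wb = undefined, posted = undefined \<rparr>"
  \<comment> \<open>The state of the schedule pairs the configuration with the index
    \<open>j\<close> of the current target \<open>e j\<close>; the index advances exactly when that
    target departs.\<close>
  define Z where "Z = rec_nat (c0, 0) (\<lambda>_ (c, j).
      (solo A a I c (nxt (e j) c), if d (e j) c = 0 then Suc j else j))"
  define C where "C t = fst (Z t)" for t
  define J where "J t = snd (Z t)" for t
  define E where "E t = nxt (e (J t)) (C t)" for t
  define Q where "Q t \<longleftrightarrow> d (e (J t)) (C t) = 0" for t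
  have C0: "C 0 = c0" and J0: "J 0 = 0" by (simp_all add: C_def J_def Z_def)
  have CS: "C (Suc t) = solo A a I (C t) (E t)" for t
    by (simp add: C_def J_def E_def Z_def split: prod.splits)
  have JS: "J (Suc t) = (if Q t then Suc (J t) else J t)" for t
    by (simp add: C_def J_def Q_def Z_def split: prod.splits)
  have "E t \<in> I" if "valid a I (C t)" for t
    using nxt[OF that e] e by (cases "Q t") (auto simp: E_def Q_def nxt_def)
  moreover have val: "valid a I (C t)" for t
  proof (induction t)
    case 0
    show ?case by (simp add: C0 c0_def valid_def)
  next
    case (Suc t)
    then show ?case using CS calculation solo_valid by metis
  qed
  ultimately have E: "E t \<in> I" for t by blast
  have often: "\<exists>t'\<ge>t. Q t'" for t
  proof (induction "d (e (J t)) (C t)" arbitrary: t rule: less_induct)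
    case less
    show ?case
    proof (cases "Q t")
      case False
      then have "departs_after A a I (e (J t)) (d (e (J t)) (C t) - 1) (C (Suc t))"
        using nxt[OF val e] by (simp add: CS E_def Q_def)
      then have "d (e (J (Suc t))) (C (Suc t)) \<le> d (e (J t)) (C t) - 1"
        unfolding d_def[of _ "C (Suc t)"] using False by (simp add: JS Least_le)
      also have "\<dots> < d (e (J t)) (C t)" using False by (simp add: Q_def)
      finally show ?thesis using less[of "Suc t"] Suc_leD by blast
    qed blast
  qed
  \<comment> \<open>Thus the target with index \<open>j\<close> departs no earlier than time
    \<open>j\<close>, so large indices give late departures.\<close>
  have J_le: "J t \<le> t" for t
    by (induction t) (auto simp: J0 JS)
  have moves: "\<exists>t'\<ge>t. E t' = p \<and> loc (C (Suc t')) p \<noteq> loc (C t') p" if p: "p \<in> I" for p t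
  proof -
    obtain j where j: "t \<le> j" "e j = p"
      using fair_enum_frequently[OF countable_finite[OF assms(3)] p] unfolding e_def by blast
    obtain t' where t': "Q t'" "J t' = j"
      using counter_hits[of J Q 0 j, OF JS often] J0 by auto
    have Et': "E t' = p" using t' j by (simp add: E_def Q_def nxt_def)
    have "departs A a I (C t') p"
      using d[OF val p, of t'] t' j by (simp add: Q_def)
    then have "loc (C (Suc t')) p = 1 - loc (C t') p"
      by (simp add: CS Et' solo_def Let_def)
    moreover have "loc (C t') p \<in> {0, 1}" using val p by (auto simp: valid_def)
    ultimately have "loc (C (Suc t')) p \<noteq> loc (C t') p" by auto
    moreover have "t \<le> t'" using J_le[of t'] t'(2) j(1) by simp
    ultimately show ?thesis using Et' by blast
  qed
  have "execution lm A (pair_net a) I (\<lambda>_. 0) C"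
  proof (rule solo_execution[where e = E])
    show "valid a I (C 0)" by (rule val)
    show "0 \<in> known (C 0) p" for p by (simp add: C0 c0_def)
    \<comment> \<open>Fairness comes for free: an agent that moves infinitely often acts infinitely
      often.\<close>
    show "\<exists>t'\<ge>t. E t' = p" if "p \<in> I" for p t using moves[OF that] by blast
  qed (use assms E CS in auto)
  then obtain t R where R: "R \<subseteq> I" "l \<le> card R" "\<forall>t'\<ge>t. \<forall>p\<in>R. loc (C t') p = loc (C t) p"
    using q assms(4) unfolding quiescent_def by blast
  then obtain p where "p \<in> R" using assms(2) by (cases "R = {}") auto
  then show False using moves[of p t] R by (metis le_SucI subsetD)
qed

section \<open>Combining two stuck groups in one system\<close>

text \<open>The relation retains what views of agents in \<open>P\<close> depend on. Gossip is
  absent because algorithms cannot inspect it, and the nodes may differ because both have the same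
  port.\<close>

definition mirrors ::
  "'id set \<Rightarrow> 'id set \<Rightarrow> ('id, 'lab, 's, 'w) config \<Rightarrow> nat \<Rightarrow> 'id set \<Rightarrow>
   ('id, 'lab, 's, 'w) config \<Rightarrow> bool" where
  "mirrors P I c v I' c' \<longleftrightarrow> P = {q \<in> I. loc c q = v} \<and>
     (\<exists>v'. P = {q \<in> I'. loc c' q = v'} \<and> wb c v = wb c' v') \<and>
     (\<forall>q\<in>P. state c q = state c' q \<and> came c q = came c' q)"

lemma mirrors_view:
  assumes "mirrors P I c v I' c'" "valid a I c" "valid a I' c'" "p \<in> P"
  shows "view_of (pair_net a) I c p = view_of (pair_net a) I' c' p"
proof -
  obtain v' where P: "P = {q \<in> I. loc c q = v}" "P = {q \<in> I'. loc c' q = v'}" "wb c v = wb c' v'"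
    and eq: "\<And>q. q \<in> P \<Longrightarrow> state c q = state c' q \<and> came c q = came c' q"
    using assms(1) unfolding mirrors_def by blast
  have p: "p \<in> I" "loc c p = v" "p \<in> I'" "loc c' p = v'" using assms(4) P by auto
  have iff: "q \<in> I \<and> loc c q = v \<longleftrightarrow> q \<in> I' \<and> loc c' q = v'" for q using P(1,2) by blast
  have "(\<lambda>q. if q \<in> I \<and> q \<noteq> p \<and> loc c q = v then Some (state c q) else None) =
        (\<lambda>q. if q \<in> I' \<and> q \<noteq> p \<and> loc c' q = v' then Some (state c' q) else None)"
    using iff eq P(1) by (intro ext) (auto split: if_splits)
  moreover have "v \<in> {0, 1}" "v' \<in> {0, 1}"
    using assms(2,3) p by (auto simp: valid_def)
  then have "ports (pair_net a) v = ports (pair_net a) v'"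
    using pair_net_ports[of v a] pair_net_ports[of v' a] by simp
  ultimately show ?thesis
    using eq[OF assms(4)] P(3) by (simp add: view_of_def p)
qed

text \<open>Equal views give equal actions, so the original system in \<open>Y\<close> simulates the
  copy and certifies that the copied group also stays put.\<close>

lemma stuck_mirror_step:
  assumes st: "stuck A a I' P Y" and c': "c' \<in> Y" and mir: "mirrors P I c v I' c'"
    and val: "valid a I c" and p: "p \<in> P"
  shows "\<not> departs A a I c p" "solo A a I' c' p \<in> Y"
    "mirrors P I (solo A a I c p) v I' (solo A a I' c' p)"
proof -
  have val': "valid a I' c'" and no': "\<not> departs A a I' c' p" and in': "solo A a I' c' p \<in> Y"
    using st c' p unfolding stuck_def by blast+
  have view: "view_of (pair_net a) I c p = view_of (pair_net a) I' c' p"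
    by (rule mirrors_view[OF mir val val' p])
  show no: "\<not> departs A a I c p" using no' by (simp add: departs_def view)
  show "solo A a I' c' p \<in> Y" by (rule in')
  obtain v' where P: "P = {q \<in> I. loc c q = v}" "P = {q \<in> I'. loc c' q = v'}"
    using mir unfolding mirrors_def by blast
  then have "loc c p = v" "loc c' p = v'" using p by auto
  then show "mirrors P I (solo A a I c p) v I' (solo A a I' c' p)"
    using mir no no' P unfolding mirrors_def
    by (auto simp: solo_def Let_def view intro!: exI[of _ v'])
qed

text \<open>An agent acting at the other node without moving changes neither the group at
  \<open>v\<close> nor the whiteboard there.\<close>

lemma stuck_mirror_other:
  assumes "mirrors P I c v I' c'" "p \<in> I" "p \<notin> P" "\<not> departs A a I c p"
  shows "mirrors P I (solo A a I c p) v I' c'"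
proof -
  have "loc c p \<noteq> v" using assms(1-3) by (auto simp: mirrors_def)
  then show ?thesis
    using assms unfolding mirrors_def by (auto simp: solo_def Let_def)
qed

text \<open>With one group at each node, each behaves as in its own system, so no agent ever crosses
  the link and no gossip passes between the groups.\<close>

lemma stuck_pair_not_stabilizing:
  assumes st1: "stuck A a I1 P1 Y1" and st2: "stuck A a I2 P2 Y2"
    and disj: "I1 \<inter> I2 = {}" and fin: "finite I1" "finite I2"
  shows "\<not> self_stabilizing_gossip lm A"
proof
  assume stab: "self_stabilizing_gossip lm A"
  define I where "I = P1 \<union> P2"
  have P: "P1 \<noteq> {}" "P2 \<noteq> {}" "P1 \<subseteq> I1" "P2 \<subseteq> I2" "P1 \<inter> P2 = {}"
    using st1 st2 disj unfolding stuck_def by blast+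
  have "finite I" "I \<noteq> {}"
    using P fin by (auto simp: I_def intro: finite_subset)
  obtain c1 c2 where c12: "c1 \<in> Y1" "c2 \<in> Y2" using st1 st2 by (auto simp: stuck_def)
  obtain v1 v2 where v12: "P1 = {q \<in> I1. loc c1 q = v1}" "P2 = {q \<in> I2. loc c2 q = v2}"
    using st1 st2 c12 unfolding stuck_def by blast
  have val12: "valid a I1 c1" "valid a I2 c2" using st1 st2 c12 by (auto simp: stuck_def)
  \<comment> \<open>The piece of an agent is the number of its node, so \<open>g\<close> also serves
    as the location map, and node \<open>v\<close> may only ever store piece
    \<open>v\<close>.\<close>
  define g :: "'a \<Rightarrow> nat" where "g p = (if p \<in> P1 then 0 else 1)" for p
  define c0 where "c0 = \<lparr> loc = g,
      state = (\<lambda>p. if p \<in> P1 then state c1 p else state c2 p),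
      came = (\<lambda>p. if p \<in> P1 then came c1 p else came c2 p),
      known = (\<lambda>p. {g p}),
      wb = (\<lambda>v. if v = 0 then wb c1 v1 else wb c2 v2),
      posted = (\<lambda>_. {}) \<rparr>"
  define e where "e = fair_enum I"
  have e: "e t \<in> I" for t unfolding e_def by (rule fair_enum_in[OF \<open>I \<noteq> {}\<close>])
  define C where "C = rec_nat c0 (\<lambda>t c. solo A a I c (e t))"
  have C0: "C 0 = c0" and CS: "C (Suc t) = solo A a I (C t) (e t)" for t
    by (simp_all add: C_def)
  \<comment> \<open>The mirrored configurations \<open>c1\<close> and \<open>c2\<close> evolve
    independently: an action of one group advances only its own mirror.\<close>
  define Inv where "Inv c \<longleftrightarrow> valid a I c \<and>
      (\<exists>c1\<in>Y1. mirrors P1 I c 0 I1 c1) \<and> (\<exists>c2\<in>Y2. mirrors P2 I c 1 I2 c2) \<and>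
      (\<forall>p\<in>I. loc c p = g p \<and> known c p \<subseteq> {g p}) \<and> (\<forall>v. posted c v \<subseteq> {v})" for c
  have "Inv c0"
    unfolding Inv_def
  proof (intro conjI ballI allI)
    show "valid a I c0"
      using val12 P by (auto simp: valid_def c0_def g_def I_def)
    show "\<exists>c1\<in>Y1. mirrors P1 I c0 0 I1 c1"
      using c12(1) v12(1) by (intro bexI[of _ c1]) (auto simp: mirrors_def c0_def g_def I_def)
    show "\<exists>c2\<in>Y2. mirrors P2 I c0 1 I2 c2"
      using c12(2) v12(2) P(5)
      by (intro bexI[of _ c2]) (auto simp: mirrors_def c0_def g_def I_def)
  qed (auto simp: c0_def)
  moreover have "Inv (solo A a I c p)" if inv: "Inv c" and p: "p \<in> I" for c p
  proof -
    obtain d1 d2 where d: "d1 \<in> Y1" "mirrors P1 I c 0 I1 d1" "d2 \<in> Y2" "mirrors P2 I c 1 I2 d2"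
      and val: "valid a I c" and loc: "\<And>q. q \<in> I \<Longrightarrow> loc c q = g q"
      and known: "\<And>q. q \<in> I \<Longrightarrow> known c q \<subseteq> {g q}" and posted: "\<And>v. posted c v \<subseteq> {v}"
      using inv unfolding Inv_def by blast
    note s1 = stuck_mirror_step[OF st1 d(1,2) val] and s2 = stuck_mirror_step[OF st2 d(3,4) val]
    have stay: "\<not> departs A a I c p" using p s1(1) s2(1) by (auto simp: I_def)
    have m1: "\<exists>c1\<in>Y1. mirrors P1 I (solo A a I c p) 0 I1 c1"
    proof (cases "p \<in> P1")
      case True
      then show ?thesis using s1(2,3) by blast
    next
      case False
      then show ?thesis using stuck_mirror_other[OF d(2) p _ stay] d(1) by blast
    qed
    have m2: "\<exists>c2\<in>Y2. mirrors P2 I (solo A a I c p) 1 I2 c2"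
    proof (cases "p \<in> P2")
      case True
      then show ?thesis using s2(2,3) by blast
    next
      case False
      then show ?thesis using stuck_mirror_other[OF d(4) p _ stay] d(3) by blast
    qed
    have coll: "collected I c p \<subseteq> {g p}"
      using known posted loc p unfolding collected_def by fastforce
    have "loc (solo A a I c p) = loc c" using stay by (simp add: solo_def Let_def)
    moreover have "known (solo A a I c p) q \<subseteq> {g q}" if "q \<in> I" for q
      using known[OF that] coll by (auto simp: solo_def Let_def)
    moreover have "posted (solo A a I c p) v \<subseteq> {v}" for v
      using posted[of v] coll loc[OF p]
      by (auto simp: solo_def Let_def write_gossip_def split: gossip_write.splits)
    ultimately show ?thesis
      unfolding Inv_def using m1 m2 loc solo_valid[OF val p] by simp
  qed
  ultimately have inv: "Inv (C t)" for t
    by (induction t) (auto simp: C0 CS e)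
  have "execution lm A (pair_net a) I g C"
  proof (rule solo_execution[where e = e])
    show "valid a I (C 0)" using inv by (simp add: Inv_def)
    show "g p \<in> known (C 0) p" for p by (simp add: C0 c0_def)
    show "\<exists>t'\<ge>t. e t' = p" if "p \<in> I" for p t
      unfolding e_def by (rule fair_enum_frequently[OF countable_finite[OF \<open>finite I\<close>] that])
  qed (use \<open>finite I\<close> e CS in auto)
  moreover obtain p q where pq: "p \<in> P1" "q \<in> P2" using P by blast
  ultimately obtain t where "g ` I \<subseteq> known (C t) p"
    using stab unfolding self_stabilizing_gossip_def I_def by blast
  moreover have "known (C t) p \<subseteq> {g p}" using inv pq by (auto simp: Inv_def I_def)
  ultimately have "g q = g p" using pq(2) by (auto simp: I_def)
  then show False using pq P(5) by (auto simp: g_def split: if_splits)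
qed

text \<open>Infinitely many identifiers provide two disjoint sets of size \<open>k\<close>. Their
  stuck groups together need not have \<open>k\<close> members, but self-stabilization covers every
  number of agents.\<close>

lemma not_quiescent:
  fixes A :: "('id::infinite, 'lab, 's, 'w) algorithm"
  assumes "self_stabilizing_gossip lm A" "1 \<le> k" "1 \<le> l"
  shows "\<not> quiescent lm k l A"
proof
  assume q: "quiescent lm k l A"
  obtain I1 :: "'id set" where I1: "finite I1" "card I1 = k"
    using infinite_arbitrarily_large[OF infinite_class.infinite_UNIV] by blast
  then have "infinite (UNIV - I1)" using infinite_class.infinite_UNIV by (simp add: Diff_infinite_finite)
  then obtain I2 where I2: "finite I2" "card I2 = k" "I2 \<subseteq> UNIV - I1"
    using infinite_arbitrarily_large by blast
  fix a :: 'lab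
  obtain P1 Y1 P2 Y2 where st: "stuck A a I1 P1 Y1" "stuck A a I2 P2 Y2"
    using quiescent_stuck[OF q assms(3) _ _ assms(2)] I1 I2 by metis
  have "I1 \<inter> I2 = {}" using I2(3) by blast
  then show False
    using stuck_pair_not_stabilizing[OF st _ I1(1) I2(1), of lm] assms(1) by blast
qed

theorem theorem6:
  fixes lm :: link_model and k :: nat
    and T :: "('id::{infinite,linorder}, 'lab::infinite, 's, 'w::infinite) algorithm itself"
  assumes "k \<ge> 1"
  shows "quiescence_number T lm k = 0 \<and>
    (\<exists>A :: ('id, 'lab, 's, 'w) algorithm.
       self_stabilizing_gossip lm A \<and> quiescent lm k 0 A) \<and>
    (\<forall>l\<ge>1. \<not> (\<exists>A :: ('id, 'lab, 's, 'w) algorithm.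
       self_stabilizing_gossip lm A \<and> quiescent lm k l A))"
proof -
  have "quiescent lm k 0 (rotor :: ('id, 'lab, 's, 'w) algorithm)"
    by (auto simp: quiescent_def)
  then have pos: "\<exists>A :: ('id, 'lab, 's, 'w) algorithm.
      self_stabilizing_gossip lm A \<and> quiescent lm k 0 A"
    using rotor_self_stabilizing by blast
  have neg: "\<forall>l\<ge>1. \<not> (\<exists>A :: ('id, 'lab, 's, 'w) algorithm.
      self_stabilizing_gossip lm A \<and> quiescent lm k l A)"
    using not_quiescent[OF _ assms] by blast
  \<comment> \<open>Solvability at 0 alone makes the greatest solvable value 0.\<close>
  have "solvable T lm k l \<longleftrightarrow> l = 0" for l
    using pos neg by (cases l) (auto simp: solvable_def)
  then have "solvable T lm k = (\<lambda>l. l = 0)" by blast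
  then have "quiescence_number T lm k = 0"
    by (simp add: quiescence_number_def Greatest_equality)
  then show ?thesis using pos neg by blast
qed

end
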